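(* Let $\mathbf{D}=[\mathbf{d}_0|\dots|\mathbf{d}_{P-1}]\in\mathbb{C}^{L\times P}$ be a finite dictionary with normalized atoms, $\|\mathbf{d}_p\|_2=1$ for all $p$, whose atoms span $\mathbb{C}^L$, with $$\lambda_{\min}:=\inf_{\mathbf{y}\in\mathbb{C}^L,\ \|\mathbf{y}\|_2=1}\ \max_p|\langle\mathbf{y},\mathbf{d}_p\rangle|^2>0,$$ and let $\mathbf{x}\in\mathbb{R}^L$ be a signal. Fix $0<\delta<1/2$ and $0<\varepsilon<1-2\delta$ such that $\frac{2\delta}{1-(2\delta+\varepsilon)}<\sqrt{\lambda_{\min}}$, and let $0<\epsilon<1$. Suppose that approximate coefficient-domain matching pursuit with reset (as defined in the context) is run on $\mathbf{x}$ with the truncated Gram matrix $\mathbf{G}_\epsilon$, and that its reset criterion includes the two conditions $$|\boldsymbol{\varrho}_k(p_{k+1})|<\frac{\epsilon}{\delta}\sum_{l=k^{\mathrm{out}}+1}^{k}|\boldsymbol{\varrho}_{l-1}(p_l)|\qquad\text{and}\qquad |\boldsymbol{\varrho}_k(p_{k+1})|<\frac{2\delta\,\bigl(1-\varepsilon(1+\delta)^{-2}\lambda_{\min}\bigr)^{\frac{k-k^{\mathrm{out}}}{2}}}{1-(2\delta+\varepsilon)}\,\|\mathbf{r}^{\mathrm{out}}\|_2,$$ either one of which triggers a reset. Then the residual decreases exponentially: $$\|\mathbf{r}_{k+1}\|_2^2<\bigl(1-\varepsilon(1+\delta)^{-2}\lambda_{\min}\bigr)\,\|\mathbf{r}_k\|_2^2$$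 for all $k\ge 0$ for which the $(k+1)$-th selection step is performed and $\mathbf{r}_k\neq\mathbf{0}$.
   Context: The inner product on $\mathbb{C}^L$ is $\langle \mathbf{x},\mathbf{y}\rangle=\mathbf{y}^*\mathbf{x}=\sum_l \mathbf{x}(l)\overline{\mathbf{y}(l)}$ and $\|\cdot\|_2$ is the induced norm; real vectors are regarded as elements of $\mathbb{C}^L$. The Gram matrix is $\mathbf{G}=\mathbf{D}^*\mathbf{D}$, $\mathbf{G}(k,j)=\langle\mathbf{d}_j,\mathbf{d}_k\rangle$. The truncated Gram matrix $\mathbf{G}_\epsilon$ is given by $\mathbf{G}_\epsilon(k,j)=\mathbf{G}(k,j)$ if $|\mathbf{G}(k,j)|>\epsilon$ and $\mathbf{G}_\epsilon(k,j)=0$ otherwise. $\mathbf{G}_\epsilon(\bullet,p)$ denotes the $p$-th column, and $\mathbf{e}_p\in\mathbb{C}^P$ the $p$-th standard unit vector. Approximate coefficient-domain matching pursuit with reset. The counter $k\ge 0$ is the total number of selection steps performed so far, $\mathbf{c}_k\in\mathbb{C}^P$ is the total coefficient vector accumulated after $k$ selection steps ($\mathbf{c}_0=\mathbf{0}$), and $\mathbf{r}_k=\mathbf{x}-\mathbf{D}\mathbf{c}_k$ is the true residual. $k^{\mathrm{out}}$ is the value of $k$ at the most recent reset (initially $k^{\mathrm{out}}=0$), and $\mathbf{r}^{\mathrm{out}}=\mathbf{r}_{k^{\mathrm{out}}}$ (initially $\mathbf{r}^{\mathrm{out}}=\mathbf{x}$), $E^{\mathrm{out}}=\|\mathbf{r}^{\mathrm{out}}\|_2^2$.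 The algorithm consists of passes. A pass is started only if the stopping criterion is not met (otherwise the algorithm terminates with output $\mathbf{c}_{k^{\mathrm{out}}}$). At the start of a pass, the coefficient-domain residual is (re)initialized exactly: $\boldsymbol{\varrho}_k:=\mathbf{D}^*\mathbf{r}^{\mathrm{out}}=\mathbf{D}^*(\mathbf{x}-\mathbf{D}\mathbf{c}_k)$ with $k=k^{\mathrm{out}}$. Within a pass, as long as the reset criterion is not met, a selection step is performed: $$p_{k+1}=\operatorname{argmax}_p|\boldsymbol{\varrho}_k(p)|,\quad \mathbf{c}_{k+1}=\mathbf{c}_k+\boldsymbol{\varrho}_k(p_{k+1})\mathbf{e}_{p_{k+1}},\quad \boldsymbol{\varrho}_{k+1}=\boldsymbol{\varrho}_k-\boldsymbol{\varrho}_k(p_{k+1})\,\mathbf{G}_\epsilon(\bullet,p_{k+1}),$$ and then $k$ is increased by one ($p_{k+1}$ is any maximizing index). The reset criterion is evaluated before each selection step, using the current $\boldsymbol{\varrho}_k$ and its maximizing index $p_{k+1}$; if it is met, the pass ends without performing that step, and $k^{\mathrm{out}}:=k$, $\mathbf{r}^{\mathrm{out}}:=\mathbf{r}_k$, $E^{\mathrm{out}}:=\|\mathbf{r}_k\|_2^2$ are updated (this is a reset). When the reset is triggered at the would-be $(k+1)$-th selection step, $\boldsymbol{\varrho}_k$ henceforth denotes the reinitialized vector $\mathbf{D}^*(\mathbf{x}-\mathbf{D}\mathbf{c}_k)$. Both the stopping and the reset criterion may consist of any number of conditions and are met as soon as any one of their conditions is met. Empty sums are zero. *)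

theory Defs
  imports "HOL-Analysis.Analysis"
begin

(* A dictionary of P atoms in C^L is a matrix D :: complex^'p^'l; the atom d_p is column p D.
   The library norm on complex^'n is the one induced by cinner. *)

definition cinner :: "complex^'n \<Rightarrow> complex^'n \<Rightarrow> complex" where
  "cinner x y = (\<Sum>i\<in>UNIV. x $ i * cnj (y $ i))"

definition cvec :: "real^'n \<Rightarrow> complex^'n" where
  "cvec x = (\<chi> i. complex_of_real (x $ i))"

definition adjoint_mat :: "complex^'p^'l \<Rightarrow> complex^'l^'p" where
  "adjoint_mat D = (\<chi> p i. cnj (D $ i $ p))"

definition gram :: "complex^'p^'l \<Rightarrow> complex^'p^'p" where
  "gram D = adjoint_mat D ** D"

definition trunc_gram :: "real \<Rightarrow> complex^'p^'l \<Rightarrow> complex^'p^'p" where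
  "trunc_gram \<tau> D = (\<chi> k j. if cmod (gram D $ k $ j) > \<tau> then gram D $ k $ j else 0)"

definition lambda_min :: "complex^'p^'l \<Rightarrow> real" where
  "lambda_min D =
     (INF y\<in>{y :: complex^'l. norm y = 1}. MAX p. (cmod (cinner y (column p D)))\<^sup>2)"

(* Outer: about to evaluate the stopping criterion; Inner: inside a pass, about to evaluate the
   reset criterion; Halted: terminated, carrying the output. *)
datatype 'v phase = Outer | Inner | Halted 'v

(* coef s l, rho s l and sel s l are the l-th members of the sequences of coefficient vectors,
   coefficient-domain residuals and selected indices.  Entries with l > steps s (for coef and rho,
   before the first pass also rho s 0; for sel also l = 0) are not yet meaningful.
   n_resets is not used by the algorithm itself; it makes the states of a run pairwise distinct,
   so that letting the criteria depend on the current state only is no restriction. *)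
record ('l, 'p) amp_state =
  phase :: "(complex^'p) phase"
  steps :: nat
  k_out :: nat
  r_out :: "complex^'l"
  E_out :: real
  coef :: "nat \<Rightarrow> complex^'p"
  rho :: "nat \<Rightarrow> complex^'p"
  sel :: "nat \<Rightarrow> 'p"
  n_resets :: nat

type_synonym ('l, 'p) stop_condition = "('l, 'p) amp_state \<Rightarrow> bool"

(* The additional argument is the maximizing index p_(k+1) of the would-be next step. *)
type_synonym ('l, 'p) reset_condition = "('l, 'p) amp_state \<Rightarrow> 'p \<Rightarrow> bool"

definition residual ::
  "complex^'p^'l \<Rightarrow> complex^'l \<Rightarrow> ('l, 'p) amp_state \<Rightarrow> nat \<Rightarrow> complex^'l" where
  "residual D x s k = x - D *v coef s k"

definition amp_init :: "complex^'l \<Rightarrow> ('l::finite, 'p::finite) amp_state" where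
  "amp_init x = \<lparr>phase = Outer, steps = 0, k_out = 0, r_out = x, E_out = (norm x)\<^sup>2,
     coef = (\<lambda>_. 0), rho = (\<lambda>_. 0), sel = (\<lambda>_. undefined), n_resets = 0\<rparr>"

definition is_max_index :: "complex^'p \<Rightarrow> 'p \<Rightarrow> bool" where
  "is_max_index v p \<longleftrightarrow> is_arg_max (\<lambda>q. cmod (v $ q)) (\<lambda>_. True) p"

inductive amp_trans ::
  "complex^'p^'l \<Rightarrow> complex^'l \<Rightarrow> real \<Rightarrow>
   ('l, 'p) stop_condition set \<Rightarrow> ('l, 'p) reset_condition set \<Rightarrow>
   ('l, 'p) amp_state \<Rightarrow> ('l, 'p) amp_state \<Rightarrow> bool"
  for D x \<tau> Stop Reset
where
  halt: "amp_trans D x \<tau> Stop Reset s (s\<lparr>phase := Halted (coef s (k_out s))\<rparr>)"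
    if "phase s = Outer" "\<exists>C\<in>Stop. C s"
| start_pass: "amp_trans D x \<tau> Stop Reset s
      (s\<lparr>phase := Inner, rho := (rho s)(k_out s := adjoint_mat D *v r_out s)\<rparr>)"
    if "phase s = Outer" "\<not> (\<exists>C\<in>Stop. C s)"
| select: "amp_trans D x \<tau> Stop Reset s
      (s\<lparr>steps := Suc k,
         coef := (coef s)(Suc k := coef s k + (rho s k $ p) *s axis p 1),
         rho := (rho s)(Suc k := rho s k - (rho s k $ p) *s column p (trunc_gram \<tau> D)),
         sel := (sel s)(Suc k := p)\<rparr>)"
    if "phase s = Inner" "k = steps s" "is_max_index (rho s k) p" "\<not> (\<exists>C\<in>Reset. C s p)"
| reset: "amp_trans D x \<tau> Stop Reset s
      (s\<lparr>phase := Outer,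
         k_out := k,
         r_out := residual D x s k,
         E_out := (norm (residual D x s k))\<^sup>2,
         n_resets := Suc (n_resets s)\<rparr>)"
    if "phase s = Inner" "k = steps s" "is_max_index (rho s k) p" "\<exists>C\<in>Reset. C s p"

definition amp_reachable ::
  "complex^'p^'l \<Rightarrow> complex^'l \<Rightarrow> real \<Rightarrow>
   ('l, 'p) stop_condition set \<Rightarrow> ('l, 'p) reset_condition set \<Rightarrow>
   ('l, 'p) amp_state \<Rightarrow> bool" where
  "amp_reachable D x \<tau> Stop Reset s \<longleftrightarrow> (amp_trans D x \<tau> Stop Reset)\<^sup>*\<^sup>* (amp_init x) s"

definition reset_accumulated :: "real \<Rightarrow> real \<Rightarrow> ('l::finite, 'p::finite) reset_condition" where
  "reset_accumulated \<tau> \<delta> = (\<lambda>s p.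
     cmod (rho s (steps s) $ p)
       < \<tau> / \<delta> * (\<Sum>l = k_out s + 1..steps s. cmod (rho s (l - 1) $ sel s l)))"

definition decay_factor :: "complex^'p^'l \<Rightarrow> real \<Rightarrow> real \<Rightarrow> real" where
  "decay_factor D \<delta> \<epsilon> = 1 - \<epsilon> * (1 + \<delta>) powi (-2) * lambda_min D"

definition reset_threshold ::
  "complex^'p^'l \<Rightarrow> real \<Rightarrow> real \<Rightarrow> ('l, 'p) reset_condition" where
  "reset_threshold D \<delta> \<epsilon> = (\<lambda>s p.
     cmod (rho s (steps s) $ p)
       < 2 * \<delta> * decay_factor D \<delta> \<epsilon> powr ((real (steps s) - real (k_out s)) / 2)
         / (1 - (2 * \<delta> + \<epsilon>)) * norm (r_out s))"

end

theory Submission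
  imports Defs
begin

text \<open>
  Within a pass, \<open>\<rho>\<^sub>k\<close> is a perturbation of the true coefficient vector \<open>D\<^sup>* r\<^sub>k\<close>.  Both
  are updated by a multiple \<open>\<rho>\<^sub>k(p)\<close> of a column of a Gram matrix, and the exact and the truncated
  Gram matrix differ by at most \<open>\<tau>\<close> in each entry; so every selection step adds at most
  \<open>\<tau> |\<rho>\<^sub>k(p)|\<close> to the error of each coefficient, and the accumulated error is at most
  \<open>\<tau>\<close> times the sum in the condition \<^const>\<open>reset_accumulated\<close>.  A step is performed only if this
  condition fails, hence only if every coefficient is known up to \<open>\<delta> M\<close>, where
  \<open>M = |\<rho>\<^sub>k(p)|\<close> is the largest modulus of an entry of \<open>\<rho>\<^sub>k\<close>.

  This has two consequences.  First, no true coefficient exceeds \<open>(1 + \<delta>) M\<close>, so the definition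
  of \<open>\<lambda>\<^sub>m\<^sub>i\<^sub>n\<close> gives \<open>\<lambda>\<^sub>m\<^sub>i\<^sub>n \<parallel>r\<^sub>k\<parallel>\<^sup>2 \<le> (1 + \<delta>)\<^sup>2 M\<^sup>2\<close>.  Second, subtracting \<open>\<rho>\<^sub>k(p) d\<^sub>p\<close> from
  the residual instead of the exact projection still lowers the energy by at least
  \<open>(1 - 2 \<delta>) M\<^sup>2\<close>.  Together, the energy is multiplied by at most
  \<open>1 - (1 - 2 \<delta>) (1 + \<delta>)\<^sup>-\<^sup>2 \<lambda>\<^sub>m\<^sub>i\<^sub>n\<close> (lemma \<open>residual_step_decay\<close>), and
  \<open>\<epsilon> < 1 - 2 \<delta>\<close> makes the claimed inequality strict.  The error bound and the decay of
  all past steps form an invariant of the transition system (lemma \<open>amp_invariant_reachable\<close>).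
\<close>

section \<open>Inner products and Gram matrices\<close>

lemma Re_cinner: "Re (cinner x y) = inner x y"
  by (simp add: cinner_def inner_vec_def inner_complex_def)

lemma cinner_diff_left: "cinner (x - y) z = cinner x z - cinner y z"
  by (simp add: cinner_def left_diff_distrib sum_subtractf)

lemma cinner_scale_left: "cinner (c *s x) y = c * cinner x y"
  by (simp add: cinner_def sum_distrib_left mult.assoc)

lemma cinner_scale_right: "cinner x (c *s y) = cnj c * cinner x y"
  by (simp add: cinner_def sum_distrib_left mult_ac)

lemma norm_vector_scalar_mult:
  fixes x :: "complex^'n"
  shows "norm (c *s x) = cmod c * norm x"
  by (simp add: norm_vec_def norm_mult L2_set_right_distrib)

lemma adjoint_mat_mult_component: "(adjoint_mat D *v y) $ q = cinner y (column q D)"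
  by (simp add: adjoint_mat_def matrix_vector_mult_def cinner_def column_def mult.commute)

lemma gram_component: "gram D $ q $ p = cinner (column p D) (column q D)"
  by (simp add: gram_def adjoint_mat_def matrix_matrix_mult_def cinner_def column_def mult.commute)

lemma norm_trunc_gram_diff_le:
  assumes "0 \<le> \<tau>"
  shows "cmod (gram D $ q $ p - trunc_gram \<tau> D $ q $ p) \<le> \<tau>"
  using assms by (simp add: trunc_gram_def)

lemma matrix_vector_mult_axis:
  fixes D :: "'a::comm_ring_1^'p^'l"
  shows "D *v axis p 1 = column p D"
  by (simp add: vec_eq_iff matrix_vector_mult_def column_def axis_def if_distrib cong: if_cong)

lemma residual_update:
  fixes D :: "complex^'p^'l"
  shows "x - D *v (c + a *s axis p 1) = (x - D *v c) - a *s column p D"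
  by (simp add: matrix_vector_right_distrib vector_scalar_commute matrix_vector_mult_axis)

section \<open>Decay in one selection step\<close>

text \<open>Homogeneity turns the infimum over the unit sphere into a bound for every vector.\<close>

lemma lambda_min_le:
  fixes D :: "complex^'p^'l"
  assumes bound: "\<And>q. cmod (cinner y (column q D)) \<le> B"
  shows "lambda_min D * (norm y)\<^sup>2 \<le> B\<^sup>2"
proof (cases "y = 0")
  case True
  then show ?thesis by simp
next
  case False
  define u where "u = complex_of_real (inverse (norm y)) *s y"
  have u: "norm u = 1"
    using False by (simp add: u_def norm_vector_scalar_mult norm_inverse)
  have "lambda_min D \<le> (MAX q. (cmod (cinner u (column q D)))\<^sup>2)"
    unfolding lambda_min_def
  proof (rule cINF_lower)
    have "0 \<le> (MAX q. (cmod (cinner z (column q D)))\<^sup>2)" for z :: "complex^'l"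
      by (rule order_trans[OF zero_le_power2 Max_ge]) auto
    then show "bdd_below ((\<lambda>z. MAX q. (cmod (cinner z (column q D)))\<^sup>2) ` {z. norm z = 1})"
      by (auto intro: bdd_belowI[of _ 0])
  qed (use u in simp)
  also have "\<dots> \<le> (B / norm y)\<^sup>2"
  proof (rule Max.boundedI)
    fix v assume "v \<in> range (\<lambda>q. (cmod (cinner u (column q D)))\<^sup>2)"
    then obtain q where v: "v = (cmod (cinner u (column q D)))\<^sup>2" by blast
    have "cmod (cinner u (column q D)) = cmod (cinner y (column q D)) / norm y"
      by (simp add: u_def cinner_scale_left norm_mult norm_inverse norm_divide divide_inverse)
    also have "\<dots> \<le> B / norm y"
      using bound[of q] by (simp add: divide_right_mono)
    finally have "cmod (cinner u (column q D)) \<le> B / norm y" .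
    then show "v \<le> (B / norm y)\<^sup>2"
      unfolding v by (intro power_mono) auto
  qed auto
  finally show ?thesis
    using False by (simp add: power_divide field_simps)
qed

text \<open>
  With \<open>c = \<langle>r, d\<rangle>\<close> the energy drops by exactly \<open>|c|\<^sup>2\<close>; an error \<open>e = c - \<langle>r, d\<rangle>\<close> costs
  at most \<open>2 |c| |e|\<close>.
\<close>

lemma energy_decrease:
  fixes r d :: "complex^'l"
  assumes d: "norm d = 1" and err: "cmod (c - cinner r d) \<le> \<delta> * cmod c"
  shows "(norm (r - c *s d))\<^sup>2 \<le> (norm r)\<^sup>2 - (1 - 2 * \<delta>) * (cmod c)\<^sup>2"
proof -
  define e where "e = c - cinner r d"
  have "(norm (r - c *s d))\<^sup>2 = (norm r)\<^sup>2 - 2 * inner r (c *s d) + (norm (c *s d))\<^sup>2"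
    by (simp add: power2_norm_eq_inner inner_diff_left inner_diff_right inner_commute)
  also have "inner r (c *s d) = Re (cnj c * cinner r d)"
    by (simp add: Re_cinner[symmetric] cinner_scale_right)
  also have "cnj c * cinner r d = cnj c * c - cnj c * e"
    by (simp add: e_def algebra_simps)
  also have "Re \<dots> = (cmod c)\<^sup>2 - Re (cnj c * e)"
    by (simp add: cmod_def power2_eq_square)
  also have "norm (c *s d) = cmod c"
    using d by (simp add: norm_vector_scalar_mult)
  finally have expand:
    "(norm (r - c *s d))\<^sup>2 = (norm r)\<^sup>2 - (cmod c)\<^sup>2 + 2 * Re (cnj c * e)"
    by simp
  have "Re (cnj c * e) \<le> cmod c * cmod e"
    using complex_Re_le_cmod[of "cnj c * e"] by (simp add: norm_mult)
  also have "\<dots> \<le> cmod c * (\<delta> * cmod c)"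
    using err by (intro mult_left_mono) (auto simp: e_def)
  finally show ?thesis
    unfolding expand by (simp add: power2_eq_square algebra_simps)
qed

text \<open>
  The maximality of \<open>p\<close> is used to compare all true coefficients with the single number
  \<open>|v(p)|\<close>, which is then eliminated between \<open>lambda_min_le\<close> and \<open>energy_decrease\<close>.
\<close>

lemma residual_step_decay:
  fixes D :: "complex^'p^'l"
  assumes normalized: "norm (column p D) = 1"
    and delta: "0 < \<delta>" "\<delta> < 1 / 2"
    and max: "is_max_index v p"
    and err: "\<And>q. cmod (v $ q - cinner r (column q D)) \<le> \<delta> * cmod (v $ p)"
  shows "(norm (r - (v $ p) *s column p D))\<^sup>2 \<le> decay_factor D \<delta> (1 - 2 * \<delta>) * (norm r)\<^sup>2"
proof -
  define M where "M = cmod (v $ p)"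
  have "cmod (cinner r (column q D)) \<le> (1 + \<delta>) * M" for q
  proof -
    have "cmod (cinner r (column q D)) \<le> cmod (v $ q) + cmod (v $ q - cinner r (column q D))"
      using norm_triangle_ineq4[of "v $ q" "v $ q - cinner r (column q D)"] by simp
    moreover have "cmod (v $ q) \<le> M"
      using max by (simp add: is_max_index_def is_arg_max_linorder M_def)
    ultimately show ?thesis
      using err[of q] by (simp add: M_def algebra_simps)
  qed
  then have "lambda_min D * (norm r)\<^sup>2 \<le> (1 + \<delta>)\<^sup>2 * M\<^sup>2"
    using lambda_min_le[of r D "(1 + \<delta>) * M"] by (simp add: power_mult_distrib)
  then have "(1 + \<delta>) powi (-2) * lambda_min D * (norm r)\<^sup>2 \<le> M\<^sup>2"
    using delta by (simp add: power_int_minus field_simps)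
  then have "(1 - 2 * \<delta>) * ((1 + \<delta>) powi (-2) * lambda_min D * (norm r)\<^sup>2) \<le> (1 - 2 * \<delta>) * M\<^sup>2"
    using delta by (intro mult_left_mono) auto
  moreover have "(norm (r - (v $ p) *s column p D))\<^sup>2 \<le> (norm r)\<^sup>2 - (1 - 2 * \<delta>) * M\<^sup>2"
    unfolding M_def by (rule energy_decrease[OF normalized err])
  ultimately show ?thesis
    by (simp add: decay_factor_def algebra_simps)
qed

section \<open>Error and decay along a run\<close>

text \<open>
  The coefficient error is meaningful only inside a pass: between a reset and the next pass the
  stored \<open>\<rho>\<close> is outdated.  What has to survive until the next pass is that \<open>r_out\<close> is the
  true residual at \<open>k_out\<close>, and that no step separates the two.  The decay rate is stated with
  \<open>1 - 2 \<delta>\<close> and \<open>\<le>\<close>, so that vanishing residuals need no exception.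
\<close>

definition amp_invariant ::
  "complex^'p^'l \<Rightarrow> complex^'l \<Rightarrow> real \<Rightarrow> real \<Rightarrow> ('l::finite, 'p::finite) amp_state \<Rightarrow> bool" where
  "amp_invariant D x \<tau> \<delta> s \<longleftrightarrow>
     k_out s \<le> steps s \<and>
     (phase s = Outer \<longrightarrow> k_out s = steps s \<and> r_out s = residual D x s (steps s)) \<and>
     (phase s = Inner \<longrightarrow>
        (\<forall>q. cmod (rho s (steps s) $ q - cinner (residual D x s (steps s)) (column q D))
          \<le> \<tau> * (\<Sum>l = k_out s + 1..steps s. cmod (rho s (l - 1) $ sel s l)))) \<and>
     (\<forall>k<steps s. (norm (residual D x s (k + 1)))\<^sup>2
        \<le> decay_factor D \<delta> (1 - 2 * \<delta>) * (norm (residual D x s k))\<^sup>2)"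

text \<open>
  Since \<open>D\<^sup>* r\<close> changes by the same multiple of a column of the exact Gram matrix, the error
  vector grows only by that multiple of a column of the truncation error.  The failed reset
  condition bounds the error that is already present by \<open>\<delta> M\<close>, which gives the decay.
\<close>

lemma amp_invariant_select:
  fixes D :: "complex^'p^'l" and s :: "('l, 'p) amp_state"
  assumes normalized: "\<And>p. norm (column p D) = 1"
    and delta: "0 < \<delta>" "\<delta> < 1 / 2"
    and tau: "0 < \<tau>"
    and inv: "amp_invariant D x \<tau> \<delta> s"
    and inner: "phase s = Inner" and k: "k = steps s"
    and max: "is_max_index (rho s k) p"
    and no_reset: "\<not> reset_accumulated \<tau> \<delta> s p"
    and t: "t = s\<lparr>steps := Suc k,
         coef := (coef s)(Suc k := coef s k + (rho s k $ p) *s axis p 1),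
         rho := (rho s)(Suc k := rho s k - (rho s k $ p) *s column p (trunc_gram \<tau> D)),
         sel := (sel s)(Suc k := p)\<rparr>"
  shows "amp_invariant D x \<tau> \<delta> t"
proof -
  define a where "a = rho s k $ p"
  define S where "S = (\<Sum>l = k_out s + 1..k. cmod (rho s (l - 1) $ sel s l))"
  have out: "k_out s \<le> k"
    and err: "\<And>q. cmod (rho s k $ q - cinner (residual D x s k) (column q D)) \<le> \<tau> * S"
    and decay: "\<And>j. j < k \<Longrightarrow> (norm (residual D x s (Suc j)))\<^sup>2
        \<le> decay_factor D \<delta> (1 - 2 * \<delta>) * (norm (residual D x s j))\<^sup>2"
    using inv inner unfolding amp_invariant_def by (simp_all add: S_def k)
  have res_old: "residual D x t j = residual D x s j" if "j \<le> k" for j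
    using that by (simp add: residual_def t)
  have res_new: "residual D x t (Suc k) = residual D x s k - a *s column p D"
    by (simp add: residual_def t a_def residual_update)
  have "\<tau> * S \<le> \<delta> * cmod a"
    using no_reset delta by (simp add: reset_accumulated_def S_def a_def k field_simps)
  then have "cmod (rho s k $ q - cinner (residual D x s k) (column q D)) \<le> \<delta> * cmod a" for q
    using err[of q] by linarith
  then have new_decay: "(norm (residual D x t (Suc k)))\<^sup>2
      \<le> decay_factor D \<delta> (1 - 2 * \<delta>) * (norm (residual D x t k))\<^sup>2"
    unfolding res_new res_old[OF order_refl] a_def
    by (intro residual_step_decay normalized delta max)
  have "(\<Sum>l = k_out s + 1..Suc k. cmod (rho t (l - 1) $ sel t l)) = S + cmod a"
  proof -
    have "(\<Sum>l = k_out s + 1..k. cmod (rho t (l - 1) $ sel t l)) = S"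
      unfolding S_def by (intro sum.cong) (auto simp: t)
    then show ?thesis
      using out by (simp add: t a_def)
  qed
  moreover have "cmod (rho t (Suc k) $ q - cinner (residual D x t (Suc k)) (column q D))
      \<le> \<tau> * (S + cmod a)" for q
  proof -
    have "rho t (Suc k) $ q - cinner (residual D x t (Suc k)) (column q D)
        = (rho s k $ q - cinner (residual D x s k) (column q D))
          + a * (gram D $ q $ p - trunc_gram \<tau> D $ q $ p)"
      unfolding res_new
      by (simp add: t a_def cinner_diff_left cinner_scale_left gram_component column_def
          algebra_simps)
    also have "cmod \<dots> \<le> cmod (rho s k $ q - cinner (residual D x s k) (column q D))
        + cmod a * cmod (gram D $ q $ p - trunc_gram \<tau> D $ q $ p)"
      by (metis norm_triangle_ineq norm_mult)
    also have "\<dots> \<le> \<tau> * S + cmod a * \<tau>"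
      using tau by (intro add_mono err mult_left_mono norm_trunc_gram_diff_le) auto
    finally show ?thesis
      by (simp add: algebra_simps)
  qed
  moreover have "(norm (residual D x t (j + 1)))\<^sup>2
      \<le> decay_factor D \<delta> (1 - 2 * \<delta>) * (norm (residual D x t j))\<^sup>2" if "j < Suc k" for j
    using that decay[of j] new_decay by (cases "j = k") (auto simp: res_old)
  ultimately show ?thesis
    using out inner unfolding amp_invariant_def by (simp add: t)
qed

lemma amp_invariant_trans:
  fixes D :: "complex^'p^'l" and s t :: "('l, 'p) amp_state"
  assumes normalized: "\<And>p. norm (column p D) = 1"
    and delta: "0 < \<delta>" "\<delta> < 1 / 2"
    and tau: "0 < \<tau>"
    and reset: "reset_accumulated \<tau> \<delta> \<in> Reset"
    and trans: "amp_trans D x \<tau> Stop Reset s t"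
    and inv: "amp_invariant D x \<tau> \<delta> s"
  shows "amp_invariant D x \<tau> \<delta> t"
  using trans
proof cases
  case halt
  then show ?thesis
    using inv by (simp add: amp_invariant_def residual_def)
next
  case start_pass
  \<comment> \<open>The reinitialized coefficients are exact, which matches the empty sum.\<close>
  then show ?thesis
    using inv by (simp add: amp_invariant_def residual_def adjoint_mat_mult_component)
next
  case (select k p)
  then show ?thesis
    using reset by (intro amp_invariant_select[OF normalized delta tau inv]) auto
next
  case (reset k p)
  then show ?thesis
    using inv by (simp add: amp_invariant_def residual_def)
qed

lemma amp_invariant_reachable:
  fixes D :: "complex^'p^'l" and s :: "('l, 'p) amp_state"
  assumes "\<And>p. norm (column p D) = 1"
    and "0 < \<delta>" "\<delta> < 1 / 2"
    and "0 < \<tau>"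
    and "reset_accumulated \<tau> \<delta> \<in> Reset"
    and "amp_reachable D x \<tau> Stop Reset s"
  shows "amp_invariant D x \<tau> \<delta> s"
proof -
  have "(amp_trans D x \<tau> Stop Reset)\<^sup>*\<^sup>* (amp_init x) s"
    using assms(6) by (simp add: amp_reachable_def)
  then show ?thesis
  proof induction
    case base
    show ?case
      by (simp add: amp_invariant_def amp_init_def residual_def)
  next
    case (step t u)
    then show ?case
      using assms(1-5) by (blast intro: amp_invariant_trans)
  qed
qed

theorem theorem2:
  fixes D :: "complex^'p^'l"
    and x :: "real^'l"
    and \<delta> \<epsilon> \<tau> :: real
    and Stop :: "('l, 'p) stop_condition set"
    and Reset :: "('l, 'p) reset_condition set"
    and s :: "('l, 'p) amp_state"
    and k :: nat
  assumes normalized: "\<And>p. norm (column p D) = 1"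
    and spanning: "vec.span (columns D) = UNIV"
    and lambda_pos: "lambda_min D > 0"
    and delta: "0 < \<delta>" "\<delta> < 1 / 2"
    and epsilon: "0 < \<epsilon>" "\<epsilon> < 1 - 2 * \<delta>"
    and delta_lambda: "2 * \<delta> / (1 - (2 * \<delta> + \<epsilon>)) < sqrt (lambda_min D)"
    and tau: "0 < \<tau>" "\<tau> < 1"
    and reset_conditions: "reset_accumulated \<tau> \<delta> \<in> Reset" "reset_threshold D \<delta> \<epsilon> \<in> Reset"
    and run: "amp_reachable D (cvec x) \<tau> Stop Reset s"
    and step_performed: "k < steps s"
    and nonzero: "residual D (cvec x) s k \<noteq> 0"
  shows "(norm (residual D (cvec x) s (k + 1)))\<^sup>2
       < (1 - \<epsilon> * (1 + \<delta>) powi (-2) * lambda_min D) * (norm (residual D (cvec x) s k))\<^sup>2"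
proof -
  have "amp_invariant D (cvec x) \<tau> \<delta> s"
    using normalized delta tau(1) reset_conditions(1) run by (rule amp_invariant_reachable)
  then have "(norm (residual D (cvec x) s (k + 1)))\<^sup>2
      \<le> decay_factor D \<delta> (1 - 2 * \<delta>) * (norm (residual D (cvec x) s k))\<^sup>2"
    using step_performed by (simp add: amp_invariant_def)
  also have "\<dots> < decay_factor D \<delta> \<epsilon> * (norm (residual D (cvec x) s k))\<^sup>2"
  proof (rule mult_strict_right_mono)
    have "0 < (1 + \<delta>) powi (-2) * lambda_min D"
      using delta lambda_pos by (intro mult_pos_pos zero_less_power_int) auto
    from mult_strict_right_mono[OF epsilon(2) this]
    show "decay_factor D \<delta> (1 - 2 * \<delta>) < decay_factor D \<delta> \<epsilon>"
      by (simp add: decay_factor_def mult.assoc)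
  qed (use nonzero in simp)
  finally show ?thesis
    by (simp add: decay_factor_def)
qed

end
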